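(* Let $S=\{a_n\}_{n\in\mathbb N}$ be a sequence of complex numbers satisfying (i)–(iii) of the context, with exponent of convergence $\alpha$, and let $F$ be a characteristic function of $S$ of minimal growth order, i.e. an entire function with zeros exactly at $S$ (counting multiplicity) of the form $F=e^{\omega}H$ with $\omega$ a polynomial of degree at most $\lfloor\alpha\rfloor$ and $H$ the Hadamard product of the context. Let $F(z)=\sum_{j=0}^\infty c_jz^j$. Then $$\zeta_S(n)=-\operatorname{Res}\left[z^{-n}\frac{d}{dz}\ln F(z);\ z=0\right]=-n\,b_n,\qquad n\in\mathbb N,\ n>\alpha,$$ where $$b_1=\frac{c_1}{c_0},\qquad b_j=\frac{c_j}{c_0}-\sum_{\ell=1}^{j-1}\left(\frac{\ell}{j}\right)\frac{c_{j-\ell}}{c_0}b_\ell,\quad j\ge2,$$ implying $$\zeta_S(n)=-n\frac{c_n}{c_0}-\sum_{\ell=\lfloor\alpha\rfloor+1}^{n-1}\frac{c_{n-\ell}}{c_0}\zeta_S(\ell)+\sum_{\ell=1}^{\lfloor\alpha\rfloor}\ell\,\frac{c_{n-\ell}}{c_0}b_\ell,\qquad n\in\mathbb N,\ n>\alpha.$$ In particular, if $\alpha<1$ then $$\zeta_S(n)=-n\frac{c_n}{c_0}-\sum_{\ell=1}^{n-1}\frac{c_{n-\ell}}{c_0}\zeta_S(\ell),\qquad n\in\mathbb N.$$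
   Context: Assumptions on $S=\{a_n\}_{n\in\mathbb N}\subset\mathbb C$: (i) $0<|a_1|\le|a_2|\le\dots\to\infty$; (ii) $\alpha=\limsup_{n\to\infty}(\ln n)/(\ln|a_n|)$ is finite; (iii) there exist $\varepsilon>0$ and $\Psi\in[-\pi,\pi)$ such that all $a_n\in\mathcal I_\varepsilon=\{z\in\mathbb C:\operatorname{Arg}(z)\notin(\Psi-\varepsilon,\Psi+\varepsilon)\}$ (arguments modulo $2\pi$). The $\zeta$-function is $\zeta_S(s)=\sum_{n=1}^\infty a_n^{-s}$ for $\Re(s)>\alpha$. The Hadamard product is, with $k=\lfloor\alpha\rfloor+1$, $$H(z)=\prod_{n=1}^{\infty}\left(1-\frac{z}{a_n}\right)\exp\left[\sum_{j=1}^{k-1}\frac1j\left(\frac{z}{a_n}\right)^j\right].$$ $\mathbb N=\{1,2,\dots\}$ and $\frac{d}{dz}\ln F=F'/F$. *)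

theory Defs
  imports "HOL-Complex_Analysis.Complex_Analysis"
begin

text \<open>
  Sequences are functions on \<^typ>\<open>nat\<close> of which only the values at indices \<open>n \<ge> 1\<close> matter; in
  series and products over \<open>n = 1, 2, \<dots>\<close> the summation index is therefore shifted by \<^const>\<open>Suc\<close>.
\<close>

definition conv_exponent :: "(nat \<Rightarrow> complex) \<Rightarrow> ereal" where
  "conv_exponent a = limsup (\<lambda>n. ereal (ln (real n) / ln (cmod (a n))))"

text \<open>Arguments are understood modulo \<open>2 * pi\<close>, hence the quantification over all their values.\<close>

definition sector_complement :: "real \<Rightarrow> real \<Rightarrow> complex set" where
  "sector_complement \<Psi> \<epsilon> =
     {z. \<forall>m::int. Arg z + 2 * pi * of_int m \<notin> {\<Psi> - \<epsilon><..<\<Psi> + \<epsilon>}}"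

text \<open>
  The logarithm cut along the ray of angle \<open>\<Psi>\<close>, with imaginary part in
  \<open>{\<Psi><..<\<Psi> + 2 * pi}\<close> off the cut; for \<open>\<Psi> = -pi\<close> this is the principal branch.
\<close>

definition Ln_cut :: "real \<Rightarrow> complex \<Rightarrow> complex" where
  "Ln_cut \<Psi> z = Ln (z * cis (- (\<Psi> + pi))) + \<i> * of_real (\<Psi> + pi)"

text \<open>
  The powers \<open>a\<^sub>n\<^sup>-\<^sup>s\<close> are formed with the branch above, whose cut the sequence avoids.
  At integers \<open>s\<close> the choice of the branch has no influence.
\<close>

definition zeta_seq :: "real \<Rightarrow> (nat \<Rightarrow> complex) \<Rightarrow> complex \<Rightarrow> complex" where
  "zeta_seq \<Psi> a s = (\<Sum>i. exp (- s * Ln_cut \<Psi> (a (Suc i))))"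

definition hadamard_product :: "nat \<Rightarrow> (nat \<Rightarrow> complex) \<Rightarrow> complex \<Rightarrow> complex" where
  "hadamard_product k a z =
     (\<Prod>i. (1 - z / a (Suc i)) * exp (\<Sum>j=1..k-1. 1 / of_nat j * (z / a (Suc i)) ^ j))"

definition zeros_exactly_at :: "(complex \<Rightarrow> complex) \<Rightarrow> (nat \<Rightarrow> complex) \<Rightarrow> bool" where
  "zeros_exactly_at F a \<longleftrightarrow>
     (\<forall>z. F z = 0 \<longleftrightarrow> (\<exists>n\<ge>1. a n = z)) \<and>
     (\<forall>z. F z = 0 \<longrightarrow> zorder F z = int (card {n. n \<ge> 1 \<and> a n = z}))"

definition min_order_char_fun ::
  "(nat \<Rightarrow> complex) \<Rightarrow> real \<Rightarrow> (complex \<Rightarrow> complex) \<Rightarrow> bool" where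
  "min_order_char_fun a \<alpha> F \<longleftrightarrow>
     F holomorphic_on UNIV \<and> zeros_exactly_at F a \<and>
     (\<exists>\<omega> :: complex poly. degree \<omega> \<le> nat \<lfloor>\<alpha>\<rfloor> \<and>
        (\<forall>z. F z = exp (poly \<omega> z) * hadamard_product (nat \<lfloor>\<alpha>\<rfloor> + 1) a z))"

end

theory Submission
  imports Defs
begin

text \<open>
  Let \<open>k = \<lfloor>\<alpha>\<rfloor> + 1\<close>. Since \<open>k > \<alpha>\<close>, the series \<open>\<Sum>\<^sub>i \<bar>a\<^sub>i\<bar>\<^sup>-\<^sup>k\<close> converges, and \<open>0\<close> is at positive distance
  \<open>\<bar>a\<^sub>1\<bar>\<close> from the zeros. The exponential in a Hadamard factor removes exactly the terms of
  degree less than \<open>k\<close> from the Taylor series of \<open>ln (1 - w)\<close>, so for \<open>\<bar>z\<bar> < \<bar>a\<^sub>1\<bar>\<close>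
  each factor is \<open>exp (- \<Sum>\<^bsub>m\<ge>k\<^esub> (z/a\<^sub>i)\<^sup>m / m)\<close>. The double series over \<open>i\<close> and \<open>m \<ge> k\<close>
  converges absolutely; summing over \<open>i\<close> first produces the values \<open>\<zeta>(m)\<close>, whence
  \<open>F(z) = exp (\<omega>(z) - \<Sum>\<^bsub>m\<ge>k\<^esub> \<zeta>(m) z\<^sup>m / m)\<close> near \<open>0\<close>
  (lemmas \<open>canonical_product_eq_exp\<close> and \<open>hadamard_product_eq_exp\<close>).
  Working with the logarithm itself makes it unnecessary to differentiate an infinite product.

  Let \<open>g\<^sub>m\<close> be the coefficients of this exponent. The polynomial \<open>\<omega>\<close> has degree less than \<open>k\<close>, so
  \<open>m g\<^sub>m = - \<zeta>(m)\<close> for \<open>m \<ge> k\<close>. On the other hand \<open>m g\<^sub>m\<close> is the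
  coefficient of \<open>z\<^sup>m\<^sup>-\<^sup>1\<close> in \<open>F'/F\<close>, which is the residue in question. Finally, comparing
  coefficients in \<open>F' = (F'/F) F\<close> gives a recurrence for the \<open>g\<^sub>m\<close>, which is the one that
  defines the \<open>b\<^sub>m\<close> (lemma \<open>log_coeffs_unique\<close>); the recurrence for \<open>\<zeta>\<close> is a rearrangement of it.
\<close>

section \<open>Convergence of the zeta series\<close>

lemma exp_Ln_cut: "z \<noteq> 0 \<Longrightarrow> exp (Ln_cut \<Psi> z) = z"
  by (simp add: Ln_cut_def exp_add cis_conv_exp [symmetric] cis_mult mult.assoc flip: of_real_add)

lemma exp_of_nat_Ln_cut:
  assumes "z \<noteq> 0"
  shows "exp (- of_nat m * Ln_cut \<Psi> z) = (1 / z) ^ m"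
proof -
  have "exp (- of_nat m * Ln_cut \<Psi> z) = exp (of_nat m * (- Ln_cut \<Psi> z))"
    by simp
  also have "\<dots> = (1 / z) ^ m"
    unfolding exp_of_nat_mult exp_minus exp_Ln_cut[OF assms] inverse_eq_divide ..
  finally show ?thesis .
qed

text \<open>
  For \<open>\<alpha> < \<beta> < m\<close> the definition of the exponent gives \<open>n < \<bar>a\<^sub>n\<bar>\<^sup>\<beta>\<close> eventually, so
  \<open>\<bar>a\<^sub>n\<bar>\<^sup>-\<^sup>m\<close> is dominated by \<open>n\<close> to the power \<open>- m / \<beta> < - 1\<close>.
\<close>

lemma summable_powers_above_conv_exponent:
  assumes lim: "filterlim (\<lambda>n. cmod (a n)) at_top sequentially"
    and exponent: "conv_exponent a = ereal \<alpha>"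
    and m: "m \<ge> 1" "real m > \<alpha>"
  shows "summable (\<lambda>i. cmod (1 / a (Suc i)) ^ m)"
proof -
  \<comment> \<open>The maximum makes \<open>\<beta>\<close> positive, so that one may divide by it below.\<close>
  define \<beta> where "\<beta> = (max \<alpha> 0 + real m) / 2"
  have \<beta>: "\<beta> > 0" "\<beta> > \<alpha>" "\<beta> < real m"
    using m by (auto simp: \<beta>_def max_def)
  have "limsup (\<lambda>n. ereal (ln (real n) / ln (cmod (a n)))) < ereal \<beta>"
    using exponent \<beta> by (simp add: conv_exponent_def)
  then have ev1: "\<forall>\<^sub>F n in sequentially. ereal (ln (real n) / ln (cmod (a n))) < ereal \<beta>"
    by (rule Limsup_lessD)
  have ev2: "\<forall>\<^sub>F n in sequentially. cmod (a n) > 1"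
    using lim by (simp add: filterlim_at_top_dense)
  have "\<forall>\<^sub>F n in sequentially. norm (cmod (1 / a n) ^ m) \<le> real n powr (- (real m / \<beta>))"
    using ev1 ev2 eventually_gt_at_top[of 0]
  proof eventually_elim
    case (elim n)
    have lnpos: "ln (cmod (a n)) > 0"
      using elim by (intro ln_gt_zero)
    have "ln (real n) < \<beta> * ln (cmod (a n))"
      using elim lnpos by (simp add: field_simps)
    then have "(real m / \<beta>) * ln (real n) \<le> (real m / \<beta>) * (\<beta> * ln (cmod (a n)))"
      using \<beta> by (intro mult_left_mono) auto
    then have "(real m / \<beta>) * ln (real n) \<le> real m * ln (cmod (a n))"
      using \<beta> by simp
    then have "real n powr (real m / \<beta>) \<le> cmod (a n) powr real m"
      using elim by (auto simp: powr_def)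
    also have "\<dots> = cmod (a n) ^ m"
      using elim by (intro powr_realpow) linarith
    finally have "inverse (cmod (a n) ^ m) \<le> inverse (real n powr (real m / \<beta>))"
      using elim by (intro le_imp_inverse_le) auto
    then show ?case
      by (simp add: norm_divide power_divide powr_minus field_simps)
  qed
  moreover have "summable (\<lambda>n. real n powr (- (real m / \<beta>)))"
    using \<beta> by (subst summable_real_powr_iff) (simp add: field_simps)
  ultimately have "summable (\<lambda>n. cmod (1 / a n) ^ m)"
    by (rule summable_comparison_test_ev)
  then show ?thesis
    by (subst summable_Suc_iff)
qed

section \<open>The logarithm of a canonical product\<close>

lemma elementary_factor_log_series:
  fixes w :: complex
  assumes "cmod w < 1" and "k \<ge> 1"
  shows "(\<lambda>m. if k \<le> m then w ^ m / of_nat m else 0) sums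
           (- Ln (1 - w) - (\<Sum>j=1..k-1. 1 / of_nat j * w ^ j))"
proof -
  have "(\<lambda>m. - (w ^ m / of_nat m)) sums Ln (1 - w)"
    using Ln_series'[of "- w"] assms by simp
  then have "(\<lambda>m. w ^ m / of_nat m) sums (- Ln (1 - w))"
    using sums_minus by fastforce
  moreover have "(\<lambda>m. if m \<in> {1..k-1} then 1 / of_nat m * w ^ m else 0) sums
                   (\<Sum>j=1..k-1. 1 / of_nat j * w ^ j)"
    by (rule sums_If_finite_set) simp
  ultimately have "(\<lambda>m. w ^ m / of_nat m -
        (if m \<in> {1..k-1} then 1 / of_nat m * w ^ m else 0)) sums
        (- Ln (1 - w) - (\<Sum>j=1..k-1. 1 / of_nat j * w ^ j))"
    by (rule sums_diff)
  also have "(\<lambda>m. w ^ m / of_nat m - (if m \<in> {1..k-1} then 1 / of_nat m * w ^ m else 0))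
           = (\<lambda>m. if k \<le> m then w ^ m / of_nat m else 0)"
    \<comment> \<open>At \<open>m = 0\<close> the quotient \<open>w\<^sup>0 / 0\<close> is \<open>0\<close>.\<close>
    using assms by (intro ext) (auto simp: not_le Suc_le_eq)
  finally show ?thesis .
qed

text \<open>
  A Fubini argument: the terms \<open>w\<^sub>i\<^sup>m / m\<close> with \<open>m \<ge> k\<close> are dominated by \<open>\<bar>w\<^sub>i\<bar>\<^sup>k q\<^sup>m\<^sup>-\<^sup>k\<close>, whose
  double series is a product of two convergent series. The sum over \<open>m\<close> first is the logarithm
  of the product; the sum over \<open>i\<close> first is the series of power sums.
\<close>

lemma canonical_product_eq_exp:
  fixes w :: "nat \<Rightarrow> complex"
  assumes bound: "\<And>i. cmod (w i) \<le> q" and "q < 1" and "k \<ge> 1"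
    and summable: "summable (\<lambda>i. cmod (w i) ^ k)"
  obtains L where "(\<lambda>m. if k \<le> m then (\<Sum>i. w i ^ m) / of_nat m else 0) sums L"
    and "(\<Prod>i. (1 - w i) * exp (\<Sum>j=1..k-1. 1 / of_nat j * w i ^ j)) = exp (- L)"
proof -
  define f where "f = (\<lambda>i m. if k \<le> m then w i ^ m / of_nat m else 0)"
  define h where "h = (\<lambda>i. - Ln (1 - w i) - (\<Sum>j=1..k-1. 1 / of_nat j * w i ^ j))"
  have q: "0 \<le> q"
    using bound[of 0] norm_ge_zero order_trans by blast
  have w1: "cmod (w i) < 1" for i
    using bound[of i] \<open>q < 1\<close> by linarith
  have rows: "f i sums h i" for i
    using elementary_factor_log_series[OF w1[of i] \<open>k \<ge> 1\<close>] by (simp add: f_def h_def)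

  have "summable (\<lambda>m. q ^ (m - k))"
    using q \<open>q < 1\<close> by (subst summable_iff_shift[of _ k, symmetric]) (simp add: summable_geometric)
  then have geometric: "((\<lambda>m. q ^ (m - k)) has_sum (\<Sum>m. q ^ (m - k))) UNIV"
    using q by (intro sums_nonneg_imp_has_sum summable_sums) auto
  have "(\<lambda>(i, m). cmod (w i) ^ k * q ^ (m - k)) summable_on UNIV \<times> UNIV"
  proof (rule summable_on_SigmaI)
    show "((\<lambda>m. case (i, m) of (i, m) \<Rightarrow> cmod (w i) ^ k * q ^ (m - k)) has_sum
            cmod (w i) ^ k * (\<Sum>m. q ^ (m - k))) UNIV" for i
      using has_sum_cmult_right[OF geometric] by simp
    have "(\<lambda>i. cmod (w i) ^ k) summable_on UNIV"
      using summable by (simp add: summable_on_UNIV_nonneg_real_iff)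
    then show "(\<lambda>i. cmod (w i) ^ k * (\<Sum>m. q ^ (m - k))) summable_on UNIV"
      by (rule summable_on_cmult_left)
  qed (use q in auto)
  then have "(\<lambda>x. norm (case x of (i, m) \<Rightarrow> f i m)) summable_on UNIV \<times> UNIV"
  proof (rule Infinite_Sum.abs_summable_on_comparison_test', clarify)
    fix i m :: nat
    show "norm (f i m) \<le> cmod (w i) ^ k * q ^ (m - k)"
    proof (cases "k \<le> m")
      case True
      then have "norm (f i m) = cmod (w i) ^ m / real m"
        by (simp add: f_def norm_divide norm_power)
      also have "\<dots> \<le> cmod (w i) ^ m / 1"
        using True \<open>k \<ge> 1\<close> by (intro divide_left_mono) auto
      also have "\<dots> = cmod (w i) ^ k * cmod (w i) ^ (m - k)"
        using True by (simp flip: power_add)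
      also have "\<dots> \<le> cmod (w i) ^ k * q ^ (m - k)"
        using bound[of i] by (intro mult_left_mono power_mono) auto
      finally show ?thesis .
    qed (use q in \<open>simp add: f_def\<close>)
  qed
  then have double: "(\<lambda>(i, m). f i m) summable_on UNIV \<times> UNIV"
    by (rule abs_summable_summable)
  then have double': "(\<lambda>(m, i). f i m) summable_on UNIV \<times> UNIV"
    by (subst (asm) summable_on_swap) (simp add: case_prod_unfold)
  define L where "L = infsum (\<lambda>(i, m). f i m) (UNIV \<times> UNIV)"
  have L: "((\<lambda>(i, m). f i m) has_sum L) (UNIV \<times> UNIV)"
    unfolding L_def using double by (rule has_sum_infsum)
  then have L': "((\<lambda>(m, i). f i m) has_sum L) (UNIV \<times> UNIV)"
    by (subst (asm) has_sum_swap) (simp add: case_prod_unfold)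

  have "(f i has_sum h i) UNIV" for i
    using has_sum_infsum[OF summable_on_SigmaD1[OF double, of i]] rows[of i]
    by (metis UNIV_I has_sum_imp_sums sums_unique2)
  then have "(h has_sum L) UNIV"
    using has_sum_SigmaD[OF L, of h] by simp
  then have "(\<lambda>i. - h i) sums (- L)"
    by (intro sums_minus has_sum_imp_sums)
  then have "(\<Prod>i. exp (- h i)) = exp (- L)"
    using prodinf_exp[of "\<lambda>i. - h i"] by (simp add: sums_iff)
  moreover have "exp (- h i) = (1 - w i) * exp (\<Sum>j=1..k-1. 1 / of_nat j * w i ^ j)" for i
  proof -
    have "1 - w i \<noteq> 0"
      using w1[of i] by auto
    then show ?thesis
      by (simp add: h_def exp_add)
  qed
  ultimately have prod: "(\<Prod>i. (1 - w i) * exp (\<Sum>j=1..k-1. 1 / of_nat j * w i ^ j)) = exp (- L)"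
    by simp

  have columns: "((\<lambda>i. f i m) has_sum (if k \<le> m then (\<Sum>i. w i ^ m) / of_nat m else 0)) UNIV" for m
  proof (cases "k \<le> m")
    case True
    have 1: "((\<lambda>i. f i m) has_sum infsum (\<lambda>i. f i m) UNIV) UNIV"
      using summable_on_SigmaD1[OF double', of m] by (intro has_sum_infsum) auto
    then have "(\<lambda>i. of_nat m * f i m) sums (of_nat m * infsum (\<lambda>i. f i m) UNIV)"
      by (intro sums_mult has_sum_imp_sums)
    then have "(\<lambda>i. w i ^ m) sums (of_nat m * infsum (\<lambda>i. f i m) UNIV)"
      using True \<open>k \<ge> 1\<close> by (simp add: f_def)
    then show ?thesis
      using 1 True \<open>k \<ge> 1\<close> by (simp add: sums_iff)
  qed (simp add: f_def)
  have "((\<lambda>m. if k \<le> m then (\<Sum>i. w i ^ m) / of_nat m else 0) has_sum L) UNIV"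
    using has_sum_SigmaD[OF L'] columns by simp
  then show ?thesis
    using that prod has_sum_imp_sums by blast
qed

text \<open>
  The case \<open>w\<^sub>i = z / a\<^sub>i\<close>, where the power sums are \<open>\<zeta>(m) z\<^sup>m\<close>. The bound \<open>q = \<bar>z\<bar> / r\<close> is
  uniform in \<open>i\<close> because the disc of radius \<open>r\<close> contains no \<open>a\<^sub>i\<close>.
\<close>

lemma hadamard_product_eq_exp:
  fixes a :: "nat \<Rightarrow> complex"
  assumes "r > 0" and away: "\<And>i. r \<le> cmod (a (Suc i))" and "k \<ge> 1"
    and summable: "\<And>m. m \<ge> k \<Longrightarrow> summable (\<lambda>i. cmod (1 / a (Suc i)) ^ m)"
    and z: "cmod z < r"
  obtains L where
    "(\<lambda>m. (if k \<le> m then zeta_seq \<Psi> a (of_nat m) / of_nat m else 0) * z ^ m) sums L"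
    and "hadamard_product k a z = exp (- L)"
proof -
  have nz: "a (Suc i) \<noteq> 0" for i
    using away[of i] \<open>r > 0\<close> by auto
  have zeta: "(\<Sum>i. (z / a (Suc i)) ^ m) = zeta_seq \<Psi> a (of_nat m) * z ^ m" if "m \<ge> k" for m
  proof -
    have "summable (\<lambda>i. (1 / a (Suc i)) ^ m)"
      by (rule summable_norm_cancel) (use summable[OF that] in \<open>simp add: norm_power\<close>)
    then have "(\<Sum>i. (1 / a (Suc i)) ^ m * z ^ m) = (\<Sum>i. (1 / a (Suc i)) ^ m) * z ^ m"
      by (rule suminf_mult2 [symmetric])
    moreover have "zeta_seq \<Psi> a (of_nat m) = (\<Sum>i. (1 / a (Suc i)) ^ m)"
      unfolding zeta_seq_def by (intro suminf_cong exp_of_nat_Ln_cut nz)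
    ultimately show ?thesis
      by (simp add: power_divide)
  qed
  have "cmod (z / a (Suc i)) \<le> cmod z / r" for i
    using away[of i] \<open>r > 0\<close> by (simp add: norm_divide frac_le)
  moreover have "cmod z / r < 1"
    using z \<open>r > 0\<close> by simp
  moreover have "summable (\<lambda>i. cmod (z / a (Suc i)) ^ k)"
    using summable_mult[OF summable[of k], of "cmod z ^ k"]
    by (simp add: norm_divide power_divide)
  ultimately obtain L where L:
      "(\<lambda>m. if k \<le> m then (\<Sum>i. (z / a (Suc i)) ^ m) / of_nat m else 0) sums L"
      "(\<Prod>i. (1 - z / a (Suc i)) * exp (\<Sum>j=1..k-1. 1 / of_nat j * (z / a (Suc i)) ^ j)) = exp (- L)"
    using canonical_product_eq_exp[of "\<lambda>i. z / a (Suc i)" "cmod z / r" k] \<open>k \<ge> 1\<close> by blast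
  have "(\<lambda>m. if k \<le> m then (\<Sum>i. (z / a (Suc i)) ^ m) / of_nat m else 0) =
        (\<lambda>m. (if k \<le> m then zeta_seq \<Psi> a (of_nat m) / of_nat m else 0) * z ^ m)"
    by (auto simp: zeta)
  with L show ?thesis
    using that by (simp add: hadamard_product_def)
qed

section \<open>Power series of exponentials\<close>

lemma log_deriv_of_exp_has_fps_expansion:
  fixes F G :: "complex \<Rightarrow> complex"
  assumes G: "G has_fps_expansion g" and eq: "\<forall>\<^sub>F z in nhds 0. F z = exp (G z)"
  shows "(\<lambda>z. deriv F z / F z) has_fps_expansion fps_deriv g"
    and "\<forall>\<^sub>F z in nhds 0. deriv F z = deriv G z * F z"
proof -
  obtain S where S: "open S" "0 \<in> S" "G holomorphic_on S"
    using has_fps_expansion_imp_holomorphic[OF G] by metis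
  obtain T where T: "open T" "0 \<in> T" "\<And>z. z \<in> T \<Longrightarrow> F z = exp (G z)"
    using eq unfolding eventually_nhds by metis
  have D: "deriv F z = deriv G z * F z" if "z \<in> S \<inter> T" for z
  proof -
    have "(G has_field_derivative deriv G z) (at z)"
      using S that holomorphic_derivI by auto
    then have "((\<lambda>z. exp (G z)) has_field_derivative deriv G z * F z) (at z)"
      using T that by (auto intro!: derivative_eq_intros)
    then have "(F has_field_derivative deriv G z * F z) (at z)"
      using T that by (auto elim: has_field_derivative_transform_within_open[where S = T])
    then show ?thesis
      by (rule DERIV_imp_deriv)
  qed
  have near: "\<forall>\<^sub>F z in nhds 0. z \<in> S \<inter> T"
    using S T by (intro eventually_nhds_in_open) auto
  then show "\<forall>\<^sub>F z in nhds 0. deriv F z = deriv G z * F z"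
    by eventually_elim (rule D)
  from near have "\<forall>\<^sub>F z in nhds 0. deriv F z / F z = deriv G z"
    by eventually_elim (use D T in auto)
  then show "(\<lambda>z. deriv F z / F z) has_fps_expansion fps_deriv g"
    using has_fps_expansion_deriv[OF G] by (subst has_fps_expansion_cong[OF _ refl])
qed

text \<open>
  Comparison of the coefficients of \<open>z\<^sup>n\<^sup>-\<^sup>1\<close> in \<open>F' = G' F\<close>.
\<close>

lemma exp_coeff_recurrence:
  fixes F G :: "complex \<Rightarrow> complex"
  assumes F: "F has_fps_expansion f" and G: "G has_fps_expansion g"
    and eq: "\<forall>\<^sub>F z in nhds 0. F z = exp (G z)" and "n \<ge> 1"
  shows "of_nat n * fps_nth f n = (\<Sum>l=1..n. of_nat l * fps_nth g l * fps_nth f (n - l))"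
proof -
  have "deriv F has_fps_expansion fps_deriv g * f"
    using has_fps_expansion_mult[OF has_fps_expansion_deriv[OF G] F]
    by (subst has_fps_expansion_cong[OF log_deriv_of_exp_has_fps_expansion(2)[OF G eq] refl])
  then have "fps_deriv f = fps_deriv g * f"
    using has_fps_expansion_deriv[OF F] fps_expansion_unique_complex by blast
  then have "fps_nth (fps_deriv f) (n - 1) = fps_nth (fps_deriv g * f) (n - 1)"
    by simp
  then have "of_nat n * fps_nth f n =
      (\<Sum>i=0..n-1. of_nat (i + 1) * fps_nth g (i + 1) * fps_nth f (n - 1 - i))"
    using \<open>n \<ge> 1\<close> unfolding fps_mult_nth fps_deriv_nth by simp
  also have "\<dots> = (\<Sum>l=1..n. of_nat l * fps_nth g l * fps_nth f (n - l))"
    using \<open>n \<ge> 1\<close> by (intro sum.reindex_bij_witness[of _ "\<lambda>l. l - 1" "\<lambda>i. i + 1"]) auto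
  finally show ?thesis .
qed

text \<open>
  Since \<open>c\<^sub>0 \<noteq> 0\<close>, the recurrence expressing that \<open>c\<close> is the coefficient sequence of the exponential
  of \<open>g\<close> can be solved for \<open>g\<^sub>n\<close>, \<open>n \<ge> 1\<close>; the constant term \<open>g\<^sub>0\<close> is left undetermined.
\<close>

lemma log_coeffs_unique:
  fixes b c g :: "nat \<Rightarrow> complex"
  assumes "c 0 \<noteq> 0"
    and g: "\<And>n. n \<ge> 1 \<Longrightarrow> of_nat n * c n = (\<Sum>l=1..n. of_nat l * g l * c (n - l))"
    and b: "\<And>n. n \<ge> 1 \<Longrightarrow>
              b n = c n / c 0 - (\<Sum>l=1..n-1. (of_nat l / of_nat n) * (c (n - l) / c 0) * b l)"
    and "n \<ge> 1"
  shows "b n = g n"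
  using \<open>n \<ge> 1\<close>
proof (induction n rule: less_induct)
  case (less n)
  have split: "{1..n} = insert n {1..n-1}"
    using less.prems by auto
  have "of_nat n * c n = of_nat n * g n * c 0 + (\<Sum>l=1..n-1. of_nat l * g l * c (n - l))"
    using g[OF less.prems] less.prems unfolding split by simp
  then have "g n = c n / c 0 - (\<Sum>l=1..n-1. of_nat l * g l * c (n - l)) / (of_nat n * c 0)"
    using \<open>c 0 \<noteq> 0\<close> less.prems by (simp add: field_simps)
  also have "(\<Sum>l=1..n-1. of_nat l * g l * c (n - l)) / (of_nat n * c 0)
           = (\<Sum>l=1..n-1. (of_nat l / of_nat n) * (c (n - l) / c 0) * b l)"
    unfolding sum_divide_distrib using less by (intro sum.cong) auto
  finally show ?case
    using b[OF less.prems] by simp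
qed

section \<open>The zeta function at integers\<close>

theorem theorem2p8:
  fixes a :: "nat \<Rightarrow> complex" and \<alpha> \<epsilon> \<Psi> :: real
    and F :: "complex \<Rightarrow> complex" and b c :: "nat \<Rightarrow> complex"
  assumes "0 < cmod (a 1)"
    and "\<And>n. n \<ge> 1 \<Longrightarrow> cmod (a n) \<le> cmod (a (Suc n))"
    and "filterlim (\<lambda>n. cmod (a n)) at_top sequentially"
    and "conv_exponent a = ereal \<alpha>"
    and "\<epsilon> > 0" and "\<Psi> \<in> {-pi..<pi}"
    and "\<And>n. n \<ge> 1 \<Longrightarrow> a n \<in> sector_complement \<Psi> \<epsilon>"
    and "min_order_char_fun a \<alpha> F"
    and "\<And>z. (\<lambda>j. c j * z ^ j) sums F z"
    and "b 1 = c 1 / c 0"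
    and "\<And>j. j \<ge> 2 \<Longrightarrow>
           b j = c j / c 0 - (\<Sum>l=1..j-1. (of_nat l / of_nat j) * (c (j - l) / c 0) * b l)"
  shows "(\<forall>n::nat. n \<ge> 1 \<and> real n > \<alpha> \<longrightarrow>
            zeta_seq \<Psi> a (of_nat n)
              = - residue (\<lambda>z. z powi (- int n) * (deriv F z / F z)) 0 \<and>
            - residue (\<lambda>z. z powi (- int n) * (deriv F z / F z)) 0 = - of_nat n * b n) \<and>
         (\<forall>n::nat. n \<ge> 1 \<and> real n > \<alpha> \<longrightarrow>
            zeta_seq \<Psi> a (of_nat n)
              = - of_nat n * (c n / c 0)
                - (\<Sum>l=nat \<lfloor>\<alpha>\<rfloor>+1..n-1. (c (n - l) / c 0) * zeta_seq \<Psi> a (of_nat l))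
                + (\<Sum>l=1..nat \<lfloor>\<alpha>\<rfloor>. of_nat l * (c (n - l) / c 0) * b l)) \<and>
         (\<alpha> < 1 \<longrightarrow> (\<forall>n::nat. n \<ge> 1 \<longrightarrow>
            zeta_seq \<Psi> a (of_nat n)
              = - of_nat n * (c n / c 0)
                - (\<Sum>l=1..n-1. (c (n - l) / c 0) * zeta_seq \<Psi> a (of_nat l))))"
proof -
  define k where "k = nat \<lfloor>\<alpha>\<rfloor> + 1"
  define \<zeta> where "\<zeta> = (\<lambda>m::nat. zeta_seq \<Psi> a (of_nat m))"
  have k: "k \<ge> 1"
    by (simp add: k_def)
  have k_le_iff: "k \<le> n \<longleftrightarrow> real n > \<alpha>" if "n \<ge> 1" for n
    using that unfolding k_def by linarith
  obtain \<omega> where \<omega>: "degree \<omega> < k"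
      "\<And>z. F z = exp (poly \<omega> z) * hadamard_product k a z"
    using assms(8) unfolding min_order_char_fun_def k_def by (auto simp: less_Suc_eq_le)
  have away: "cmod (a 1) \<le> cmod (a (Suc i))" for i
  proof -
    have "incseq (\<lambda>i. cmod (a (Suc i)))"
      using assms(2) by (intro incseq_SucI) simp
    from incseqD[OF this, of 0 i] show ?thesis
      by simp
  qed
  have summable: "summable (\<lambda>i. cmod (1 / a (Suc i)) ^ m)" if "m \<ge> k" for m
    using summable_powers_above_conv_exponent[OF assms(3,4)] that k k_le_iff[of m] by simp

  define g where "g = (\<lambda>m. coeff \<omega> m - (if k \<le> m then \<zeta> m / of_nat m else 0))"
  define G where "G = eval_fps (Abs_fps g)"
  have expansion: "(\<lambda>m. g m * z ^ m) sums G z \<and> F z = exp (G z)" if z: "cmod z < cmod (a 1)" for z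
  proof -
    obtain L where L:
        "(\<lambda>m. (if k \<le> m then \<zeta> m / of_nat m else 0) * z ^ m) sums L"
        "hadamard_product k a z = exp (- L)"
      using hadamard_product_eq_exp[OF assms(1) away k summable z] unfolding \<zeta>_def by metis
    have "(\<lambda>m. coeff \<omega> m * z ^ m) sums poly \<omega> z"
      unfolding poly_altdef by (rule sums_finite) (auto simp: coeff_eq_0)
    from sums_diff[OF this L(1)] have *: "(\<lambda>m. g m * z ^ m) sums (poly \<omega> z - L)"
      by (simp add: g_def left_diff_distrib)
    then have "G z = poly \<omega> z - L"
      by (simp add: G_def eval_fps_def sums_iff)
    with * L \<omega> show ?thesis
      by (simp add: exp_diff exp_minus divide_inverse)
  qed
  have near: "\<forall>\<^sub>F z in nhds 0. cmod z < cmod (a 1)"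
    using eventually_nhds_in_open[of "ball 0 (cmod (a 1))" "0::complex"] assms(1)
    unfolding mem_ball_0 by simp
  have G: "G has_fps_expansion Abs_fps g"
    by (rule has_fps_expansionI) (use near in eventually_elim, use expansion in auto)
  have F_eq: "\<forall>\<^sub>F z in nhds 0. F z = exp (G z)"
    using near by eventually_elim (use expansion in auto)
  have F: "F has_fps_expansion Abs_fps c"
    using assms(9) by (intro has_fps_expansionI) simp

  have "c 0 = F 0"
    using assms(9)[of 0] powser_sums_zero_iff by metis
  then have c0: "c 0 \<noteq> 0"
    using expansion[of 0] assms(1) by simp
  have b_rec: "b n = c n / c 0 - (\<Sum>l=1..n-1. (of_nat l / of_nat n) * (c (n - l) / c 0) * b l)"
    if "n \<ge> 1" for n
    using assms(10,11) that by (cases "n = 1") auto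
  have b_eq: "b n = g n" if "n \<ge> 1" for n
    using log_coeffs_unique[OF c0 _ b_rec that] exp_coeff_recurrence[OF F G F_eq] by simp
  have zeta_eq: "\<zeta> n = - of_nat n * b n" if "k \<le> n" for n
  proof -
    have "g n = - (\<zeta> n / of_nat n)"
      using that \<omega>(1) by (simp add: g_def coeff_eq_0)
    then show ?thesis
      using b_eq[of n] that k by simp
  qed
  have residue_eq: "residue (\<lambda>z. z powi (- int n) * (deriv F z / F z)) 0 = of_nat n * b n"
    if "n \<ge> 1" for n
  proof -
    have "(\<lambda>z. z powi (- int n) * (deriv F z / F z)) = (\<lambda>z. (deriv F z / F z) / z ^ Suc (n - 1))"
      using that by (simp add: power_int_minus divide_inverse mult.commute)
    then show ?thesis
      using residue_fps_expansion_over_power_at_0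
              [OF log_deriv_of_exp_has_fps_expansion(1)[OF G F_eq], of "n - 1"] b_eq[OF that] that
      by simp
  qed

  \<comment> \<open>In the recurrence for \<open>b\<close>, the terms of index \<open>l \<ge> k\<close> are values of \<open>\<zeta>\<close>; those of smaller
    index are determined by \<open>\<omega>\<close> and stay as they are.\<close>
  have rec: "\<zeta> n = - of_nat n * (c n / c 0) - (\<Sum>l=k..n-1. (c (n - l) / c 0) * \<zeta> l)
               + (\<Sum>l=1..k-1. of_nat l * (c (n - l) / c 0) * b l)" if "k \<le> n" for n
  proof -
    have "n \<ge> 1"
      using that k by simp
    have "\<zeta> n = - of_nat n * (c n / c 0) + of_nat n *
            (\<Sum>l=1..n-1. (of_nat l / of_nat n) * (c (n - l) / c 0) * b l)"
      unfolding zeta_eq[OF that] by (subst b_rec[OF \<open>n \<ge> 1\<close>]) (simp add: algebra_simps)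
    also have "of_nat n * (\<Sum>l=1..n-1. (of_nat l / of_nat n) * (c (n - l) / c 0) * b l)
             = (\<Sum>l=1..n-1. of_nat l * (c (n - l) / c 0) * b l)"
      unfolding sum_distrib_left using \<open>n \<ge> 1\<close> by (intro sum.cong) auto
    also have "{1..n-1} = {1..k-1} \<union> {k..n-1}"
      using that k by auto
    also have "(\<Sum>l\<in>{1..k-1} \<union> {k..n-1}. of_nat l * (c (n - l) / c 0) * b l)
             = (\<Sum>l=1..k-1. of_nat l * (c (n - l) / c 0) * b l)
               + (\<Sum>l=k..n-1. of_nat l * (c (n - l) / c 0) * b l)"
      using k by (intro sum.union_disjoint) auto
    also have "(\<Sum>l=k..n-1. of_nat l * (c (n - l) / c 0) * b l)
             = - (\<Sum>l=k..n-1. (c (n - l) / c 0) * \<zeta> l)"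
      unfolding sum_negf [symmetric] by (intro sum.cong) (auto simp: zeta_eq)
    finally show ?thesis
      by simp
  qed
  have k1: "k = 1" if "\<alpha> < 1"
    using that unfolding k_def by linarith
  show ?thesis
  proof (intro conjI allI impI)
    fix n :: nat
    assume n: "n \<ge> 1 \<and> real n > \<alpha>"
    then have "k \<le> n"
      using k_le_iff by blast
    show "- residue (\<lambda>z. z powi (- int n) * (deriv F z / F z)) 0 = - of_nat n * b n"
      using residue_eq n by simp
    then show "zeta_seq \<Psi> a (of_nat n) = - residue (\<lambda>z. z powi (- int n) * (deriv F z / F z)) 0"
      using zeta_eq[OF \<open>k \<le> n\<close>] by (simp add: \<zeta>_def)
    show "zeta_seq \<Psi> a (of_nat n) = - of_nat n * (c n / c 0)
            - (\<Sum>l=nat \<lfloor>\<alpha>\<rfloor>+1..n-1. (c (n - l) / c 0) * zeta_seq \<Psi> a (of_nat l))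
            + (\<Sum>l=1..nat \<lfloor>\<alpha>\<rfloor>. of_nat l * (c (n - l) / c 0) * b l)"
      using rec[OF \<open>k \<le> n\<close>] by (simp add: \<zeta>_def k_def)
  next
    fix n :: nat
    assume "\<alpha> < 1" "n \<ge> 1"
    then show "zeta_seq \<Psi> a (of_nat n) = - of_nat n * (c n / c 0)
                 - (\<Sum>l=1..n-1. (c (n - l) / c 0) * zeta_seq \<Psi> a (of_nat l))"
      using rec[of n] k1 by (simp add: \<zeta>_def)
  qed
qed

end
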